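(* (i) Let $1<\alpha<2$. Every random walk on $\mathbb{R}$ whose jumps have a symmetric $\alpha$-stable distribution $S_\alpha(0,\gamma,0)$, $\gamma\in(0,\infty)$, is recurrent. (ii) Let $0<\alpha<1$. Every random walk on $\mathbb{R}$ whose jumps have a stable distribution $S_\alpha(0,\gamma,\delta)$, with $\gamma\in(0,\infty)$ and arbitrary shift $\delta\in\mathbb{R}$, is transient.
   Context: $S_\alpha(0,\gamma,\delta)$ denotes the one-dimensional stable distribution with index of stability $\alpha$, skewness $0$, scale $\gamma$ and shift $\delta$, i.e. the law with characteristic function $\theta\mapsto\exp(-\gamma^\alpha|\theta|^\alpha+i\delta\theta)$. A random walk with jumps $\{Z_n\}_{n\in\mathbb{N}}$ (i.i.d. real random variables) is the sequence $X_0:=0$, $X_n:=\sum_{i=1}^nZ_i$. It is recurrent if $\mathbb{P}(\liminf_{n\to\infty}|X_n|=0)=1$ and transient if $\mathbb{P}(\lim_{n\to\infty}|X_n|=\infty)=1$. *)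

theory Defs
  imports "HOL-Probability.Probability"
begin

text \<open>
  The law with skewness 0, given by its characteristic function. It is a predicate on measures,
  not a measure, so that existence of the law is not part of the definition; by
  Levy's uniqueness theorem at most one measure satisfies it for given parameters.
  At \<open>\<theta> = 0\<close> the convention \<open>0 powr \<alpha> = 0\<close> gives the correct value 1.
\<close>

definition stable_law :: "real \<Rightarrow> real \<Rightarrow> real \<Rightarrow> real measure \<Rightarrow> bool" where
  "stable_law \<alpha> \<gamma> \<delta> \<mu> \<longleftrightarrow>
     real_distribution \<mu> \<and>
     (\<forall>\<theta>. char \<mu> \<theta> =
        exp (complex_of_real (- (\<gamma> powr \<alpha> * \<bar>\<theta>\<bar> powr \<alpha>)) + \<i> * complex_of_real (\<delta> * \<theta>)))"

lemma stable_law_unique: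
  assumes "stable_law \<alpha> \<gamma> \<delta> \<mu>" and "stable_law \<alpha> \<gamma> \<delta> \<nu>"
  shows "\<mu> = \<nu>"
  using assms unfolding stable_law_def by (intro Levy_uniqueness ext) auto

text \<open>Jumps are indexed from 1; the value \<open>Z 0\<close> is irrelevant throughout.\<close>

definition iid_jumps :: "'a measure \<Rightarrow> (nat \<Rightarrow> 'a \<Rightarrow> real) \<Rightarrow> bool" where
  "iid_jumps M Z \<longleftrightarrow>
     prob_space M \<and>
     prob_space.indep_vars M (\<lambda>_. borel) Z {1..} \<and>
     (\<forall>n\<ge>1. distr M borel (Z n) = distr M borel (Z 1))"

definition random_walk :: "(nat \<Rightarrow> 'a \<Rightarrow> real) \<Rightarrow> nat \<Rightarrow> 'a \<Rightarrow> real" where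
  "random_walk Z n \<omega> = (\<Sum>i=1..n. Z i \<omega>)"

definition recurrent :: "'a measure \<Rightarrow> (nat \<Rightarrow> 'a \<Rightarrow> real) \<Rightarrow> bool" where
  "recurrent M X \<longleftrightarrow> measure M {\<omega> \<in> space M. liminf (\<lambda>n. ereal \<bar>X n \<omega>\<bar>) = 0} = 1"

definition transient :: "'a measure \<Rightarrow> (nat \<Rightarrow> 'a \<Rightarrow> real) \<Rightarrow> bool" where
  "transient M X \<longleftrightarrow> measure M {\<omega> \<in> space M. filterlim (\<lambda>n. \<bar>X n \<omega>\<bar>) at_top sequentially} = 1"

end

theory Submission
  imports Defs "HOL-Real_Asymp.Real_Asymp"
begin

text \<open>
  Write \<open>\<phi>\<close> for the characteristic function of a jump, so that that of \<open>X\<^sub>n\<close> is \<open>\<phi>\<^sup>n\<close>, with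
  modulus \<open>exp (- n \<gamma>\<^sup>\<alpha> \<bar>\<theta>\<bar>\<^sup>\<alpha>)\<close>. It is concentrated on a window of width of order
  \<open>n powr (-1/\<alpha>)\<close>. For \<open>\<delta> = 0\<close> this is also the order of the probability that \<open>X\<^sub>n\<close> lies
  in a fixed interval around 0, and for arbitrary \<open>\<delta>\<close> it is still an upper bound. The series of
  these probabilities converges for \<open>\<alpha> < 1\<close>, and for \<open>\<delta> = 0\<close> and \<open>\<alpha> > 1\<close> it diverges; this
  decides between transience and recurrence.

  Interval probabilities are compared with integrals of the characteristic function by Gaussian
  test functions. A Gaussian is, up to scaling, its own Fourier transform, so Fubini alone gives
  \<open>E exp (- (s X)\<^sup>2 / 2) = E \<phi>\<^sub>X (s N)\<close> with \<open>N\<close> standard normal (\<open>gaussian_expectation_eq\<close>).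
  A Gaussian dominates the indicator of
  an interval, up to a constant, which gives the upper bound. The lower bound uses a
  function that lies below such an indicator and has a nonnegative Fourier transform, the
  difference of Gaussians \<open>exp (- x\<^sup>2 / 2) - exp (- x\<^sup>2 / 8) / 4\<close>
  (\<open>integral_char_le_prob_interval\<close>).

  Convergence of the series gives transience by Borel-Cantelli (\<open>transient_random_walkI\<close>).
  Divergence gives recurrence by the argument of Chung and Fuchs (\<open>recurrent_random_walkI\<close>).
  Let \<open>\<rho>\<close> be the probability that the walk avoids \<open>(-2\<epsilon>, 2\<epsilon>)\<close> from time \<open>k\<close> on. After
  each visit to \<open>(-\<epsilon>, \<epsilon>)\<close> the walk, restarted there, has probability \<open>\<rho>\<close> of keeping
  distance at least \<open>2\<epsilon>\<close> from the visited position from the \<open>k\<close>-th further step on; on any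
  path this happens for at most \<open>k\<close> visits. Hence \<open>\<rho>\<close> times the diverging series is at most \<open>k\<close>, and \<open>\<rho> = 0\<close>.
\<close>

section \<open>Gaussian smoothing of interval probabilities\<close>

text \<open>
  Both sides are the double integral of \<open>exp (\<i> s t x)\<close> over the product measure.
\<close>

lemma char_duality:
  fixes \<mu> \<nu> :: "real measure" and s :: real
  assumes "real_distribution \<mu>" "real_distribution \<nu>"
  shows "(\<integral>x. char \<nu> (s * x) \<partial>\<mu>) = (\<integral>t. char \<mu> (s * t) \<partial>\<nu>)"
proof -
  interpret M: real_distribution \<mu> by fact
  interpret N: real_distribution \<nu> by fact
  interpret P: pair_prob_space \<nu> \<mu> ..
  have "integrable (\<nu> \<Otimes>\<^sub>M \<mu>) (\<lambda>(t, x). iexp (s * t * x))"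
    by (intro P.integrable_const_bound[where B=1]) (auto simp: case_prod_beta norm_mult)
  from P.Fubini_integral[OF this] show ?thesis
    by (simp add: char_def mult_ac)
qed

lemma gaussian_expectation_eq:
  assumes "real_distribution \<mu>"
  shows "(\<integral>x. exp (- (s * x)\<^sup>2 / 2) \<partial>\<mu>) = (\<integral>t. Re (char \<mu> (s * t)) \<partial>std_normal_distribution)"
proof -
  interpret M: real_distribution \<mu> by fact
  interpret N: real_distribution std_normal_distribution by (rule real_dist_normal_dist)
  have int: "integrable std_normal_distribution (\<lambda>t. char \<mu> (s * t))"
    by (rule N.integrable_const_bound[where B=1]) (auto simp: M.cmod_char_le_1)
  have "complex_of_real (\<integral>x. exp (- (s * x)\<^sup>2 / 2) \<partial>\<mu>) = (\<integral>t. char \<mu> (s * t) \<partial>std_normal_distribution)"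
    using char_duality[OF assms real_dist_normal_dist, of s]
    by (simp add: char_std_normal_distribution)
  then have "(\<integral>x. exp (- (s * x)\<^sup>2 / 2) \<partial>\<mu>) = Re (\<integral>t. char \<mu> (s * t) \<partial>std_normal_distribution)"
    by (metis Re_complex_of_real)
  then show ?thesis
    using int by simp
qed

lemma prob_interval_le_integral_cmod_char:
  assumes "real_distribution \<mu>" "K > 0"
  shows "measure \<mu> {-K..K} \<le> exp (1/2) * (\<integral>t. cmod (char \<mu> (t / K)) \<partial>std_normal_distribution)"
proof -
  interpret M: real_distribution \<mu> by fact
  interpret N: real_distribution std_normal_distribution by (rule real_dist_normal_dist)
  have "measure \<mu> {-K..K} = (\<integral>x. indicator {-K..K} x \<partial>\<mu>)"
    by simp
  also have "\<dots> \<le> (\<integral>x. exp (1/2) * exp (- ((1/K) * x)\<^sup>2 / 2) \<partial>\<mu>)"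
  proof (rule integral_mono)
    fix x
    have "1 \<le> exp (1/2) * exp (- ((1/K) * x)\<^sup>2 / 2)" if "x \<in> {-K..K}"
    proof -
      have "\<bar>(1/K) * x\<bar> \<le> 1" using that \<open>K > 0\<close> by (auto simp: abs_le_iff field_simps)
      then have "((1/K) * x)\<^sup>2 \<le> 1" by (metis abs_square_le_1)
      then show ?thesis by (subst exp_add[symmetric]) simp
    qed
    then show "indicator {-K..K} x \<le> exp (1/2) * exp (- ((1/K) * x)\<^sup>2 / 2)"
      by (auto simp: indicator_def simp del: power_mult_distrib)
  next
    show "integrable \<mu> (\<lambda>x. exp (1/2) * exp (- ((1/K) * x)\<^sup>2 / 2))"
      by (intro integrable_mult_right M.integrable_const_bound[where B=1]) auto
  qed (auto intro!: M.integrable_const_bound[where B=1])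
  also have "\<dots> = exp (1/2) * (\<integral>t. Re (char \<mu> ((1/K) * t)) \<partial>std_normal_distribution)"
    by (subst gaussian_expectation_eq[OF assms(1), symmetric]) simp
  also have "(\<integral>t. Re (char \<mu> ((1/K) * t)) \<partial>std_normal_distribution)
      \<le> (\<integral>t. cmod (char \<mu> (t / K)) \<partial>std_normal_distribution)"
  proof (rule integral_mono)
    show "integrable std_normal_distribution (\<lambda>t. cmod (char \<mu> (t / K)))"
      by (rule N.integrable_const_bound[where B=1]) (auto simp: M.cmod_char_le_1)
    show "integrable std_normal_distribution (\<lambda>t. Re (char \<mu> ((1/K) * t)))"
      by (intro integrable_Re N.integrable_const_bound[where B=1]) (auto simp: M.cmod_char_le_1)
  qed (simp add: complex_Re_le_cmod)
  finally show ?thesis by simp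
qed

text \<open>
  If \<open>N\<close> is standard normal with density \<open>g\<close>, then \<open>N / 2\<close> has density \<open>2 * g (2 * u)\<close>, which is at
  most \<open>2 * g u\<close> because \<open>g\<close> decreases in \<open>\<bar>u\<bar>\<close>.
\<close>

lemma std_normal_integral_half_le:
  fixes h :: "real \<Rightarrow> real"
  assumes [measurable]: "h \<in> borel_measurable borel" and h: "\<And>t. 0 \<le> h t" "\<And>t. h t \<le> B"
  shows "(\<integral>t. h (t / 2) \<partial>std_normal_distribution) \<le> 2 * (\<integral>t. h t \<partial>std_normal_distribution)"
proof -
  interpret N: real_distribution std_normal_distribution by (rule real_dist_normal_dist)
  have int1: "integrable std_normal_distribution h" "integrable std_normal_distribution (\<lambda>t. h (t/2))"
    by (rule N.integrable_const_bound[where B=B]; use h in auto)+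
  then have int: "integrable lborel (\<lambda>t. std_normal_density t * h t)"
    "integrable lborel (\<lambda>t. std_normal_density t * h (t / 2))"
    by (auto simp: integrable_density)
  have "(\<integral>t. h (t / 2) \<partial>std_normal_distribution) = (\<integral>t. std_normal_density t * h (t / 2) \<partial>lborel)"
    by (simp add: integral_density)
  also have "\<dots> = 2 * (\<integral>u. std_normal_density (2 * u) * h u \<partial>lborel)"
    by (subst lborel_integral_real_affine[where c=2 and t=0]) auto
  also have "\<dots> \<le> 2 * (\<integral>u. std_normal_density u * h u \<partial>lborel)"
  proof (intro mult_left_mono integral_mono int)
    show "integrable lborel (\<lambda>u. std_normal_density (2 * u) * h u)"
      using lborel_integrable_real_affine[OF int(2), of 2 0] by simp
    fix u :: real
    have "exp (- (2 * u)\<^sup>2 / 2) \<le> exp (- u\<^sup>2 / 2)"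
      by (simp add: power_mult_distrib)
    then show "std_normal_density (2 * u) * h u \<le> std_normal_density u * h u"
      unfolding std_normal_density_def by (intro mult_right_mono mult_left_mono h) auto
  qed simp
  also have "\<dots> = 2 * (\<integral>t. h t \<partial>std_normal_distribution)"
    by (simp add: integral_density)
  finally show ?thesis .
qed

text \<open>
  The test function \<open>f x = exp (- (s x)\<^sup>2 / 2) - exp (- (s x / 2)\<^sup>2 / 2) / 4\<close> is at most 1, and
  it is negative where \<open>\<bar>s x\<bar> \<ge> 3\<close>, since there the wider Gaussian wins despite its factor
  \<open>1/4\<close>. On the Fourier side the wider Gaussian is the narrower one: with a nonnegative
  characteristic function it contributes at most twice the integral of the first term, hence after
  the factor \<open>1/4\<close> at most half of it.
\<close>

lemma integral_char_le_prob_interval: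
  assumes "real_distribution \<mu>" "s > 0" and nonneg: "\<And>t. 0 \<le> Re (char \<mu> t)"
  shows "(\<integral>t. Re (char \<mu> (s * t)) \<partial>std_normal_distribution) / 2 \<le> measure \<mu> {-3/s<..<3/s}"
proof -
  interpret M: real_distribution \<mu> by fact
  define g where "g r x = exp (- (r * x)\<^sup>2 / 2)" for r x :: real
  define I where "I r = (\<integral>t. Re (char \<mu> (r * t)) \<partial>std_normal_distribution)" for r
  have g: "integrable \<mu> (g r)" "(\<integral>x. g r x \<partial>\<mu>) = I r" for r
    unfolding g_def I_def
    using gaussian_expectation_eq[OF assms(1), of r]
    by (auto intro!: M.integrable_const_bound[where B=1])
  have "I (s/2) \<le> 2 * I s"
    using std_normal_integral_half_le[of "\<lambda>t. Re (char \<mu> (s * t))" 1] nonneg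
      order_trans[OF complex_Re_le_cmod M.cmod_char_le_1]
    by (auto simp: I_def)
  then have "I s / 2 \<le> I s - (1/4) * I (s/2)" by simp
  also have "\<dots> = (\<integral>x. g s x - (1/4) * g (s/2) x \<partial>\<mu>)"
    by (simp add: g)
  also have "\<dots> \<le> (\<integral>x. indicator {-3/s<..<3/s} x \<partial>\<mu>)"
  proof (rule integral_mono)
    fix x
    show "g s x - (1/4) * g (s/2) x \<le> indicator {-3/s<..<3/s} x"
    proof (cases "\<bar>s * x\<bar> < 3")
      case True
      then have "x \<in> {-3/s<..<3/s}" using \<open>s > 0\<close> by (auto simp: field_simps abs_less_iff)
      moreover have "g s x \<le> 1" "0 \<le> g (s/2) x" by (auto simp: g_def)
      ultimately show ?thesis by simp
    next
      case False
      define q where "q = (s * x)\<^sup>2"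
      have "3\<^sup>2 \<le> \<bar>s * x\<bar>\<^sup>2" using False by (intro power_mono) auto
      then have q: "9 \<le> q" by (simp add: q_def)
      \<comment> \<open>The ratio of the two Gaussians is \<open>exp (3 q / 8)\<close>, and \<open>1 + 3/8 * 9 > 4\<close>.\<close>
      have "4 \<le> exp (3/8 * q)"
        using exp_ge_add_one_self[of "3/8 * q"] q by linarith
      then have "4 * exp (- q / 2) \<le> exp (3/8 * q) * exp (- q / 2)"
        by (intro mult_right_mono) auto
      also have "\<dots> = exp (- q / 8)" by (simp add: exp_add[symmetric])
      finally have "g s x \<le> (1/4) * g (s/2) x"
        by (simp add: g_def q_def power_mult_distrib power_divide)
      then show ?thesis by (simp add: indicator_def)
    qed
  qed (auto simp: g intro!: M.integrable_const_bound[where B=1])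
  finally show ?thesis by (simp add: I_def)
qed

text \<open>
  The standard normal density is at most 1 everywhere, and on \<open>[-1, 1]\<close> at least its value at 1.
\<close>

lemma std_normal_prob_interval_bounds:
  assumes "0 \<le> r"
  shows "measure std_normal_distribution {-r..r} \<le> 2 * r"
    and "r \<le> 1 \<Longrightarrow> 2 * r * std_normal_density 1 \<le> measure std_normal_distribution {-r..r}"
proof -
  interpret N: real_distribution std_normal_distribution by (rule real_dist_normal_dist)
  have eq: "measure std_normal_distribution {-r..r} = (\<integral>x. std_normal_density x * indicator {-r..r} x \<partial>lborel)"
    by (subst integral_density[symmetric, where 'b=real, simplified]) auto
  have int: "integrable lborel (\<lambda>x. std_normal_density x * indicator {-r..r} x)"
    by (intro integrable_real_mult_indicator) auto
  have len: "(\<integral>x. c * indicator {-r..r} x \<partial>lborel) = 2 * r * c" "integrable lborel (\<lambda>x. c * indicator {-r..r} x :: real)" for c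
    using assms by auto
  have "1 \<le> sqrt (2 * pi)"
    using pi_gt3 by simp
  then have dens_le_1: "std_normal_density x \<le> 1" for x
    unfolding std_normal_density_def by (intro mult_le_one) (auto simp: field_simps)
  have "(\<integral>x. std_normal_density x * indicator {-r..r} x \<partial>lborel) \<le> (\<integral>x. 1 * indicator {-r..r} x \<partial>lborel)"
    by (intro integral_mono int len mult_right_mono dens_le_1) auto
  then show "measure std_normal_distribution {-r..r} \<le> 2 * r"
    unfolding eq len by simp
  assume "r \<le> 1"
  have "(\<integral>x. std_normal_density 1 * indicator {-r..r} x \<partial>lborel)
      \<le> (\<integral>x. std_normal_density x * indicator {-r..r} x \<partial>lborel)"
  proof (intro integral_mono int len)
    fix x
    have "x\<^sup>2 \<le> 1" if "x \<in> {-r..r}"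
      using that \<open>r \<le> 1\<close> by (subst abs_square_le_1) auto
    then have "std_normal_density 1 \<le> std_normal_density x" if "x \<in> {-r..r}"
      using that unfolding std_normal_density_def by (intro mult_left_mono) auto
    then show "std_normal_density 1 * indicator {-r..r} x \<le> std_normal_density x * indicator {-r..r} x"
      by (auto simp: indicator_def)
  qed
  then show "2 * r * std_normal_density 1 \<le> measure std_normal_distribution {-r..r}"
    unfolding eq len .
qed

section \<open>Recurrence and transience criteria for random walks\<close>

lemma random_walk_increment:
  "random_walk Z (m + j) \<omega> - random_walk Z m \<omega> = (\<Sum>i<j. Z (m + Suc i) \<omega>)"
  by (induction j) (simp_all add: random_walk_def algebra_simps)

context
  fixes M :: "'a measure" and Z :: "nat \<Rightarrow> 'a \<Rightarrow> real"
  assumes iid: "iid_jumps M Z"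
begin

interpretation prob_space M
  using iid by (simp add: iid_jumps_def)

lemma measurable_jump: "n \<ge> 1 \<Longrightarrow> Z n \<in> borel_measurable M"
  using iid by (auto simp: iid_jumps_def indep_vars_def)

lemma distr_jump: "n \<ge> 1 \<Longrightarrow> distr M borel (Z n) = distr M borel (Z 1)"
  using iid unfolding iid_jumps_def by blast

lemma measurable_random_walk [measurable]: "random_walk Z n \<in> borel_measurable M"
  unfolding random_walk_def[abs_def] by (intro borel_measurable_sum measurable_jump) auto

lemma measurable_future_jumps [measurable]:
  "(\<lambda>\<omega> i. Z (m + Suc i) \<omega>) \<in> M \<rightarrow>\<^sub>M (\<Pi>\<^sub>M i\<in>UNIV. borel)"
  by (intro measurable_PiM_single') (auto intro: measurable_jump)

text \<open>
  The sequence of jumps after time \<open>m\<close> has the same law for every \<open>m\<close>, namely the product law;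
  this is the stationarity behind restarting the walk.
\<close>

lemma distr_future_jumps:
  "distr M (\<Pi>\<^sub>M i\<in>UNIV. borel) (\<lambda>\<omega> i. Z (m + Suc i) \<omega>) = (\<Pi>\<^sub>M i\<in>UNIV. distr M borel (Z 1))"
proof -
  have "indep_vars (\<lambda>j. PiM {m + Suc j} (\<lambda>_. borel))
      (\<lambda>j \<omega>. restrict (\<lambda>i. Z i \<omega>) {m + Suc j}) UNIV"
    using iid by (intro indep_vars_restrict[where I="{1..}"])
      (auto simp: iid_jumps_def disjoint_family_on_def)
  from indep_vars_compose2[OF this, where Y="\<lambda>j f. f (m + Suc j)" and N="\<lambda>_. borel"]
  have "indep_vars (\<lambda>_. borel) (\<lambda>j. Z (m + Suc j)) UNIV"
    by simp
  then have "distr M (\<Pi>\<^sub>M i\<in>UNIV. borel) (\<lambda>\<omega>. \<lambda>i\<in>UNIV. Z (m + Suc i) \<omega>)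
      = (\<Pi>\<^sub>M i\<in>UNIV. distr M borel (Z (m + Suc i)))"
    by (subst (asm) indep_vars_iff_distr_eq_PiM') (auto intro: measurable_jump)
  also have "\<dots> = (\<Pi>\<^sub>M i\<in>UNIV. distr M borel (Z 1))"
    by (intro PiM_cong distr_jump) auto
  finally show ?thesis by (simp only: restrict_UNIV)
qed

text \<open>
  The position at time \<open>m\<close> is a function of the jumps with index in \<open>{1..m}\<close>, which are independent of
  those with index in \<open>{Suc m..}\<close>; by stationarity the latter may be replaced by all jumps.
\<close>

lemma random_walk_markov:
  assumes [measurable]: "A \<in> sets borel" "B \<in> sets (\<Pi>\<^sub>M i\<in>(UNIV::nat set). borel)"
  shows "prob {\<omega> \<in> space M. random_walk Z m \<omega> \<in> A \<and> (\<lambda>i. Z (m + Suc i) \<omega>) \<in> B}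
    = prob {\<omega> \<in> space M. random_walk Z m \<omega> \<in> A} * prob {\<omega> \<in> space M. (\<lambda>i. Z (Suc i) \<omega>) \<in> B}"
proof -
  let ?P = "\<lambda>I. (\<Pi>\<^sub>M i\<in>(I::nat set). (borel :: real measure))"
  define A' where "A' = {f \<in> space (?P {1..m}). (\<Sum>i=1..m. f i) \<in> A}"
  define B' where "B' = {f \<in> space (?P {Suc m..}). (\<lambda>i. f (m + Suc i)) \<in> B}"
  have [measurable]: "(\<lambda>f i. f (m + Suc i)) \<in> ?P {Suc m..} \<rightarrow>\<^sub>M ?P UNIV"
    by (intro measurable_PiM_single') auto
  have sets: "A' \<in> sets (?P {1..m})" "B' \<in> sets (?P {Suc m..})"
    unfolding A'_def B'_def by measurable
  have indep: "indep_var (?P {1..m}) (\<lambda>\<omega>. restrict (\<lambda>i. Z i \<omega>) {1..m})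
      (?P {Suc m..}) (\<lambda>\<omega>. restrict (\<lambda>i. Z i \<omega>) {Suc m..})"
    using iid by (intro indep_var_restrict[where I="{1..}"]) (auto simp: iid_jumps_def)
  have past: "restrict (\<lambda>i. Z i \<omega>) {1..m} \<in> A' \<longleftrightarrow> random_walk Z m \<omega> \<in> A" for \<omega>
    by (simp add: A'_def space_PiM random_walk_def)
  have future: "restrict (\<lambda>i. Z i \<omega>) {Suc m..} \<in> B' \<longleftrightarrow> (\<lambda>i. Z (m + Suc i) \<omega>) \<in> B" for \<omega>
    by (simp add: B'_def space_PiM)
  have Int_space: "{\<omega>. P \<omega>} \<inter> space M = {\<omega> \<in> space M. P \<omega>}" for P
    by auto
  have law: "prob {\<omega> \<in> space M. (\<lambda>i. Z (n + Suc i) \<omega>) \<in> B}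
      = measure (\<Pi>\<^sub>M i\<in>UNIV. distr M borel (Z 1)) B" for n
    unfolding distr_future_jumps[of n, symmetric]
    by (subst measure_distr[OF measurable_future_jumps]) (simp_all only: assms vimage_def Int_space)
  have "prob {\<omega> \<in> space M. random_walk Z m \<omega> \<in> A \<and> (\<lambda>i. Z (m + Suc i) \<omega>) \<in> B}
      = prob {\<omega> \<in> space M. random_walk Z m \<omega> \<in> A} * prob {\<omega> \<in> space M. (\<lambda>i. Z (m + Suc i) \<omega>) \<in> B}"
    using indep_varD[OF indep sets]
    unfolding vimage_def mem_Times_iff fst_conv snd_conv past future Int_space .
  then show ?thesis
    using law[of m] law[of 0] by simp
qed

text \<open>
  Two positions within \<open>\<epsilon>\<close> of 0 are closer than \<open>2 \<epsilon>\<close> to each other. So on a fixed path all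
  times \<open>m\<close> for which \<open>E m\<close> occurs are less than \<open>k\<close> after the first one, and there are at most
  \<open>k\<close> of them; the sum is the expectation of their number.
\<close>

lemma sum_last_visits_le:
  fixes \<epsilon> :: real and k N :: nat
  defines "E \<equiv> \<lambda>m. {\<omega> \<in> space M. \<bar>random_walk Z m \<omega>\<bar> < \<epsilon> \<and>
      (\<forall>j\<ge>k. 2 * \<epsilon> \<le> \<bar>random_walk Z (m + j) \<omega> - random_walk Z m \<omega>\<bar>)}"
  shows "(\<Sum>m<N. prob (E m)) \<le> real k"
proof -
  have [measurable]: "E m \<in> events" for m
    unfolding E_def by measurable
  have "(\<Sum>m<N. prob (E m)) = expectation (\<lambda>\<omega>. \<Sum>m<N. indicator (E m) \<omega>)"
    by (subst Bochner_Integration.integral_sum) (auto intro!: integrable_const_bound[where B=1])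
  also have "\<dots> \<le> expectation (\<lambda>_. real k)"
  proof (rule integral_mono)
    fix \<omega>
    define S where "S = {m \<in> {..<N}. \<omega> \<in> E m}"
    have "card S \<le> k"
    proof (cases "S = {}")
      case False
      have fin: "finite S" by (simp add: S_def)
      define a where "a = Min S"
      have a: "a \<in> S" "\<And>m. m \<in> S \<Longrightarrow> a \<le> m"
        using fin False by (auto simp: a_def)
      have "m < a + k" if m: "m \<in> S" for m
      proof (rule ccontr)
        assume "\<not> m < a + k"
        then have j: "m = a + (m - a)" "m - a \<ge> k" by auto
        have "2 * \<epsilon> \<le> \<bar>random_walk Z m \<omega> - random_walk Z a \<omega>\<bar>"
          using a(1) j by (auto simp: S_def E_def dest!: spec[of _ "m - a"])
        moreover have "\<bar>random_walk Z m \<omega>\<bar> < \<epsilon>" "\<bar>random_walk Z a \<omega>\<bar> < \<epsilon>"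
          using a(1) m by (auto simp: S_def E_def)
        ultimately show False by linarith
      qed
      then have "S \<subseteq> {a..<a + k}" using a(2) by auto
      from card_mono[OF _ this] show ?thesis by simp
    qed simp
    moreover have "(\<Sum>m<N. indicator (E m) \<omega>) = (\<Sum>m<N. if \<omega> \<in> E m then 1 else (0::real))"
      by (intro sum.cong) (auto simp: indicator_def)
    moreover have "\<dots> = (\<Sum>m\<in>S. 1)"
      unfolding S_def by (rule sum.inter_filter[symmetric]) simp
    ultimately show "(\<Sum>m<N. indicator (E m) \<omega>) \<le> real k" by simp
  qed (auto intro!: Bochner_Integration.integrable_sum integrable_const_bound[where B=1])
  finally show ?thesis by (simp add: prob_space)
qed

text \<open>
  By independence the probability that \<open>m\<close> is one of the times counted in the preceding lemma is
  \<open>p m * \<rho>\<close>, with \<open>\<rho>\<close> the probability that the walk stays away from 0 from time \<open>k\<close> on. So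
  \<open>\<rho>\<close> times the partial sums of the diverging series is at most \<open>k\<close>, which forces \<open>\<rho> = 0\<close>.
\<close>

lemma AE_return_near_zero:
  assumes diverge: "\<not> summable (\<lambda>n. prob {\<omega> \<in> space M. \<bar>random_walk Z n \<omega>\<bar> < \<epsilon>})"
  shows "AE \<omega> in M. \<exists>n\<ge>k. \<bar>random_walk Z n \<omega>\<bar> < 2 * \<epsilon>"
proof -
  let ?X = "random_walk Z"
  define B where "B = {f \<in> space (\<Pi>\<^sub>M i\<in>(UNIV::nat set). borel :: real measure). \<forall>j\<ge>k. 2 * \<epsilon> \<le> \<bar>\<Sum>i<j. f i\<bar>}"
  have [measurable]: "B \<in> sets (\<Pi>\<^sub>M i\<in>UNIV. borel)"
    unfolding B_def by measurable
  define \<rho> where "\<rho> = prob {\<omega> \<in> space M. (\<lambda>i. Z (Suc i) \<omega>) \<in> B}"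
  define p where "p m = prob {\<omega> \<in> space M. \<bar>?X m \<omega>\<bar> < \<epsilon>}" for m
  have increments: "(\<lambda>i. Z (m + Suc i) \<omega>) \<in> B \<longleftrightarrow>
      (\<forall>j\<ge>k. 2 * \<epsilon> \<le> \<bar>?X (m + j) \<omega> - ?X m \<omega>\<bar>)" for m \<omega>
    unfolding random_walk_increment B_def by (simp add: space_PiM)
  have p\<rho>: "p m * \<rho> = prob {\<omega> \<in> space M. \<bar>?X m \<omega>\<bar> < \<epsilon> \<and>
      (\<forall>j\<ge>k. 2 * \<epsilon> \<le> \<bar>?X (m + j) \<omega> - ?X m \<omega>\<bar>)}" for m
  proof -
    have "x \<in> {-\<epsilon><..<\<epsilon>} \<longleftrightarrow> \<bar>x\<bar> < \<epsilon>" for x by auto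
    then show ?thesis
      using random_walk_markov[of "{-\<epsilon><..<\<epsilon>}" B m]
      unfolding increments p_def \<rho>_def by (simp del: greaterThanLessThan_iff)
  qed
  have bound: "(\<Sum>m<N. p m) * \<rho> \<le> real k" for N
    using sum_last_visits_le[of \<epsilon> k N] by (simp add: sum_distrib_right p\<rho>)
  have "\<rho> = 0"
  proof (rule ccontr)
    assume "\<rho> \<noteq> 0"
    then have "\<rho> > 0" by (simp add: \<rho>_def zero_less_measure_iff)
    with bound have "(\<Sum>m<N. p m) \<le> real k / \<rho>" for N
      by (simp add: field_simps)
    then have "summable p"
      by (intro summableI_nonneg_bounded) (auto simp: p_def)
    with diverge show False by (simp add: p_def[abs_def])
  qed
  then have "AE \<omega> in M. (\<lambda>i. Z (Suc i) \<omega>) \<notin> B"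
    unfolding \<rho>_def using measurable_future_jumps[of 0] by (subst (asm) prob_eq_0) auto
  then show ?thesis
  proof eventually_elim
    case (elim \<omega>)
    then show ?case
      using increments[of 0 \<omega>] by (auto simp: random_walk_def not_le)
  qed
qed

lemma recurrent_random_walkI:
  assumes diverge: "\<And>\<epsilon>. \<epsilon> > 0 \<Longrightarrow> \<not> summable (\<lambda>n. prob {\<omega> \<in> space M. \<bar>random_walk Z n \<omega>\<bar> < \<epsilon>})"
  shows "recurrent M (random_walk Z)"
proof -
  let ?X = "random_walk Z"
  have "AE \<omega> in M. \<forall>i k. \<exists>n\<ge>k. \<bar>?X n \<omega>\<bar> < 2 * inverse (real (Suc i))"
    unfolding AE_all_countable by (intro allI AE_return_near_zero diverge) auto
  then have "AE \<omega> in M. liminf (\<lambda>n. ereal \<bar>?X n \<omega>\<bar>) = 0"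
  proof eventually_elim
    case (elim \<omega>)
    have "liminf (\<lambda>n. ereal \<bar>?X n \<omega>\<bar>) \<le> ereal (2 * inverse (real (Suc i)))" for i
      unfolding liminf_SUP_INF
    proof (rule SUP_least)
      fix k
      obtain n where "n \<ge> k" "\<bar>?X n \<omega>\<bar> < 2 * inverse (real (Suc i))"
        using elim by blast
      then show "(INF n\<in>{k..}. ereal \<bar>?X n \<omega>\<bar>) \<le> ereal (2 * inverse (real (Suc i)))"
        by (intro INF_lower2[of n]) auto
    qed
    note le = this
    have "(\<lambda>i. ereal (2 * inverse (real (Suc i)))) \<longlonglongrightarrow> ereal (2 * 0)"
      by (intro tendsto_ereal tendsto_mult_left LIMSEQ_inverse_real_of_nat)
    then have "liminf (\<lambda>n. ereal \<bar>?X n \<omega>\<bar>) \<le> ereal (2 * 0)"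
      by (rule LIMSEQ_le_const) (use le in blast)
    then have "liminf (\<lambda>n. ereal \<bar>?X n \<omega>\<bar>) \<le> 0" by (simp add: zero_ereal_def)
    moreover have "0 \<le> liminf (\<lambda>n. ereal \<bar>?X n \<omega>\<bar>)"
      by (intro Liminf_bounded) auto
    ultimately show ?case by (rule antisym)
  qed
  then show ?thesis
    unfolding recurrent_def by (subst prob_Collect_eq_1) auto
qed

lemma transient_random_walkI:
  assumes converge: "\<And>K::nat. summable (\<lambda>n. prob {\<omega> \<in> space M. \<bar>random_walk Z n \<omega>\<bar> \<le> real K})"
  shows "transient M (random_walk Z)"
proof -
  let ?X = "random_walk Z"
  have tends: "filterlim (\<lambda>n. \<bar>x n\<bar>) at_top sequentially \<longleftrightarrow> (\<forall>K::nat. \<forall>\<^sub>F n in sequentially. real K < \<bar>x n\<bar>)"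
    for x :: "nat \<Rightarrow> real"
    unfolding filterlim_at_top_dense
    by (metis (no_types, lifting) eventually_mono less_trans reals_Archimedean2)
  have "AE \<omega> in M. \<forall>K::nat. \<forall>\<^sub>F n in sequentially. real K < \<bar>?X n \<omega>\<bar>"
    unfolding AE_all_countable
  proof
    fix K :: nat
    have "AE \<omega> in M. \<forall>\<^sub>F n in sequentially. \<omega> \<in> space M - {\<omega> \<in> space M. \<bar>?X n \<omega>\<bar> \<le> real K}"
      by (rule borel_cantelli_AE1) (auto intro: converge simp: emeasure_eq_measure)
    then show "AE \<omega> in M. \<forall>\<^sub>F n in sequentially. real K < \<bar>?X n \<omega>\<bar>"
      by eventually_elim (auto elim!: eventually_mono)
  qed
  then show ?thesis
    unfolding transient_def tends by (subst prob_Collect_eq_1) (auto simp: eventually_sequentially)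
qed

end

lemma char_random_walk:
  assumes iid: "iid_jumps M Z"
  shows "char (distr M borel (random_walk Z n)) t = char (distr M borel (Z 1)) t ^ n"
proof -
  interpret prob_space M using iid by (simp add: iid_jumps_def)
  have "indep_vars (\<lambda>_. borel) Z {1..n}"
    using iid by (auto simp: iid_jumps_def intro: indep_vars_subset)
  from char_distr_sum[OF this, of t]
  have "char (distr M borel (random_walk Z n)) t = (\<Prod>i\<in>{1..n}. char (distr M borel (Z i)) t)"
    by (simp add: random_walk_def[abs_def])
  also have "\<dots> = (\<Prod>i\<in>{1..n}. char (distr M borel (Z 1)) t)"
    by (intro prod.cong arg_cong[where f="\<lambda>D. char D t"] distr_jump[OF iid]) auto
  finally show ?thesis by simp
qed

lemma real_distribution_random_walk:
  assumes "iid_jumps M Z"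
  shows "real_distribution (distr M borel (random_walk Z n))"
proof -
  interpret prob_space M using assms by (simp add: iid_jumps_def)
  show ?thesis
    using measurable_random_walk[OF assms]
    by (simp add: real_distribution_def real_distribution_axioms_def prob_space_distr)
qed

section \<open>Random walks with stable jumps\<close>

text \<open>
  The integral of the modulus of the characteristic function is split at \<open>\<bar>t\<bar> = r\<close>: inside, the
  modulus is at most 1 and the window has normal probability at most \<open>2 * r\<close>; outside, the decay
  assumption is used at the edge of the window. The cut \<open>r\<close> is free so that it can shrink with the
  number of steps.
\<close>

lemma prob_interval_le_of_char_decay:
  assumes "real_distribution \<mu>" "0 < K" "0 \<le> a" "0 < \<alpha>" "0 \<le> r"
    and char_le: "\<And>t. cmod (char \<mu> t) \<le> exp (- (a * \<bar>t\<bar> powr \<alpha>))"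
  shows "measure \<mu> {-K..K} \<le> exp (1/2) * (2 * r + exp (- (a * (r / K) powr \<alpha>)))"
proof -
  interpret M: real_distribution \<mu> by fact
  interpret N: real_distribution std_normal_distribution by (rule real_dist_normal_dist)
  let ?e = "exp (- (a * (r / K) powr \<alpha>))"
  have "(\<integral>t. cmod (char \<mu> (t / K)) \<partial>std_normal_distribution)
      \<le> (\<integral>t. indicator {-r..r} t + ?e \<partial>std_normal_distribution)"
  proof (rule integral_mono)
    fix t
    show "cmod (char \<mu> (t / K)) \<le> indicator {-r..r} t + ?e"
    proof (cases "t \<in> {-r..r}")
      case True
      then show ?thesis using M.cmod_char_le_1[of "t / K"] by (simp add: add_increasing2)
    next
      case False
      then have "r / K \<le> \<bar>t / K\<bar>" using \<open>0 < K\<close> by (auto simp: field_simps)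
      then have "a * (r / K) powr \<alpha> \<le> a * \<bar>t / K\<bar> powr \<alpha>"
        using assms by (intro mult_left_mono powr_mono2) auto
      then have "exp (- (a * \<bar>t / K\<bar> powr \<alpha>)) \<le> ?e" by simp
      with char_le[of "t / K"] have "cmod (char \<mu> (t / K)) \<le> ?e" by (rule order_trans)
      then show ?thesis using False by simp
    qed
  qed (auto intro!: N.integrable_const_bound[where B=1] Bochner_Integration.integrable_add
        simp: M.cmod_char_le_1)
  also have "\<dots> = measure std_normal_distribution {-r..r} + ?e"
    by (subst Bochner_Integration.integral_add)
      (use N.prob_space in \<open>auto intro!: N.integrable_const_bound[where B=1]\<close>)
  also have "\<dots> \<le> 2 * r + ?e"
    using std_normal_prob_interval_bounds(1)[OF \<open>0 \<le> r\<close>] by simp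
  finally show ?thesis
    using prob_interval_le_integral_cmod_char[OF assms(1,2)]
    by (meson exp_ge_zero mult_left_mono order_trans)
qed

text \<open>
  On the window \<open>\<bar>t\<bar> \<le> r\<close> the characteristic function is at least \<open>exp (- 1)\<close>, by the choice of
  \<open>r\<close>; elsewhere it is nonnegative and is discarded.
\<close>

lemma prob_interval_ge_of_char_bound:
  assumes "real_distribution \<mu>" "0 < s" "0 \<le> a" "0 < \<alpha>" "0 \<le> r" "r \<le> 1" "a * (s * r) powr \<alpha> \<le> 1"
    and char_ge: "\<And>t. exp (- (a * \<bar>t\<bar> powr \<alpha>)) \<le> Re (char \<mu> t)"
  shows "exp (-1) * std_normal_density 1 * r \<le> measure \<mu> {-3/s<..<3/s}"
proof -
  interpret M: real_distribution \<mu> by fact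
  interpret N: real_distribution std_normal_distribution by (rule real_dist_normal_dist)
  have nonneg: "0 \<le> Re (char \<mu> t)" for t
    using char_ge[of t] by (meson exp_ge_zero order_trans)
  have "exp (-1) * (2 * r * std_normal_density 1) \<le> exp (-1) * measure std_normal_distribution {-r..r}"
    using assms by (intro mult_left_mono std_normal_prob_interval_bounds) auto
  also have "\<dots> = (\<integral>t. exp (-1) * indicator {-r..r} t \<partial>std_normal_distribution)"
    by simp
  also have "\<dots> \<le> (\<integral>t. Re (char \<mu> (s * t)) \<partial>std_normal_distribution)"
  proof (rule integral_mono)
    fix t
    have "exp (-1) \<le> Re (char \<mu> (s * t))" if "t \<in> {-r..r}"
    proof -
      have "\<bar>s * t\<bar> \<le> s * r"
        using that \<open>0 < s\<close> by (auto simp: abs_mult abs_le_iff)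
      then have "a * \<bar>s * t\<bar> powr \<alpha> \<le> a * (s * r) powr \<alpha>"
        using assms by (intro mult_left_mono powr_mono2) auto
      also have "\<dots> \<le> 1" by fact
      finally have "exp (-1) \<le> exp (- (a * \<bar>s * t\<bar> powr \<alpha>))" by simp
      also note char_ge[of "s * t"]
      finally show ?thesis .
    qed
    then show "exp (-1) * indicator {-r..r} t \<le> Re (char \<mu> (s * t))"
      using nonneg by (auto simp: indicator_def)
  next
    show "integrable std_normal_distribution (\<lambda>t. Re (char \<mu> (s * t)))"
      by (intro integrable_Re N.integrable_const_bound[where B=1]) (auto simp: M.cmod_char_le_1)
  qed (auto intro!: N.integrable_const_bound[where B=1])
  finally show ?thesis
    using integral_char_le_prob_interval[OF assms(1,2) nonneg] by (simp add: mult_ac)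
qed

text \<open>
  Since \<open>\<delta> = 0\<close>, the characteristic function of \<open>X\<^sub>n\<close> is real and positive, so the lower bound
  applies with a window of width of order \<open>n powr (-1/\<alpha>)\<close>. For \<open>\<alpha> > 1\<close> these widths are not
  summable.
\<close>

lemma stable_symmetric_recurrent:
  assumes \<alpha>: "1 < \<alpha>" and iid: "iid_jumps M Z"
    and stable: "stable_law \<alpha> \<gamma> 0 (distr M borel (Z 1))"
  shows "recurrent M (random_walk Z)"
proof (rule recurrent_random_walkI[OF iid])
  fix \<epsilon> :: real assume \<epsilon>: "\<epsilon> > 0"
  \<comment> \<open>The scale at which the lower bound concerns the interval of radius \<open>\<epsilon>\<close>.\<close>
  define s where "s = 3 / \<epsilon>"
  have s: "s > 0" "3 / s = \<epsilon>" using \<epsilon> by (auto simp: s_def)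
  \<comment> \<open>The maximum with 1 keeps the window below inside \<open>[-1, 1]\<close>.\<close>
  define C where "C = max 1 (\<gamma> powr \<alpha> * s powr \<alpha>)"
  have C: "C > 0" by (simp add: C_def)
  define p where "p n = measure M {\<omega> \<in> space M. \<bar>random_walk Z n \<omega>\<bar> < \<epsilon>}" for n
  define D where "D = exp (-1) * std_normal_density 1 * C powr (-1/\<alpha>)"
  have D: "D > 0" by (simp add: D_def C_def normal_density_pos)
  have lower: "D * real n powr (-1/\<alpha>) \<le> p n" for n
  proof -
    let ?\<mu> = "distr M borel (random_walk Z n)"
    define r where "r = (real n * C) powr (-1/\<alpha>)"
    have "r \<le> 1"
    proof (cases "n = 0")
      case False
      then have "1 * 1 \<le> real n * C" by (intro mult_mono) (auto simp: C_def)
      then have "r \<le> 1 powr (-1/\<alpha>)" unfolding r_def using \<alpha> by (intro powr_mono2') auto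
      then show ?thesis by simp
    qed (simp add: r_def)
    have "(real n * \<gamma> powr \<alpha>) * (s * r) powr \<alpha> = (\<gamma> powr \<alpha> * s powr \<alpha>) * (real n * r powr \<alpha>)"
      using s by (simp add: powr_mult r_def)
    also have "\<dots> \<le> C * (real n * r powr \<alpha>)"
      by (intro mult_right_mono) (auto simp: C_def)
    also have "\<dots> = (real n * C) * (real n * C) powr (-1)"
      using \<alpha> by (simp add: r_def powr_powr)
    also have "\<dots> \<le> 1"
      using C powr_one[of "real n * C"] by (simp add: powr_minus_divide divide_le_eq)
    finally have small: "(real n * \<gamma> powr \<alpha>) * (s * r) powr \<alpha> \<le> 1" .
    have char: "char ?\<mu> t = complex_of_real (exp (- (real n * \<gamma> powr \<alpha> * \<bar>t\<bar> powr \<alpha>)))" for t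
    proof -
      have "char ?\<mu> t = exp (complex_of_real (- (\<gamma> powr \<alpha> * \<bar>t\<bar> powr \<alpha>))) ^ n"
        using stable by (simp add: char_random_walk[OF iid] stable_law_def)
      also have "\<dots> = complex_of_real (exp (- (\<gamma> powr \<alpha> * \<bar>t\<bar> powr \<alpha>)) ^ n)"
        by (simp only: exp_of_real of_real_power)
      finally show ?thesis
        by (simp add: exp_of_nat_mult[symmetric] mult.assoc)
    qed
    have "exp (-1) * std_normal_density 1 * r \<le> measure ?\<mu> {-3/s<..<3/s}"
      using \<alpha> s \<open>r \<le> 1\<close> small
      by (intro prob_interval_ge_of_char_bound[where a="real n * \<gamma> powr \<alpha>" and \<alpha>=\<alpha>]
          real_distribution_random_walk iid) (auto simp: char r_def)
    also have "\<dots> = p n"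
      unfolding p_def using s measurable_random_walk[OF iid, of n]
      by (subst measure_distr) (auto intro!: arg_cong[where f="measure M"])
    finally show ?thesis
      using C by (simp add: D_def r_def powr_mult mult_ac)
  qed
  show "\<not> summable (\<lambda>n. measure M {\<omega> \<in> space M. \<bar>random_walk Z n \<omega>\<bar> < \<epsilon>})"
  proof
    assume "summable (\<lambda>n. measure M {\<omega> \<in> space M. \<bar>random_walk Z n \<omega>\<bar> < \<epsilon>})"
    then have "summable (\<lambda>n. D * real n powr (-1/\<alpha>))"
      by (rule summable_comparison_test'[where N=0]) (use lower D in \<open>simp add: p_def\<close>)
    then have "summable (\<lambda>n. real n powr (-1/\<alpha>))"
      using D by (simp add: summable_cmult_iff)
    then have "-1/\<alpha> < -1"
      by (subst (asm) summable_real_powr_iff)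
    with \<alpha> show False by (simp add: field_simps)
  qed
qed

text \<open>
  Only the modulus of the characteristic function enters, so the shift is arbitrary. With the cut
  \<open>r = n powr (-q)\<close> the decay outside it is \<open>exp (- c n powr (1 - q \<alpha>))\<close>. Both terms of the
  upper bound are summable if and only if \<open>1 < q < 1 / \<alpha>\<close>, and such \<open>q\<close> exist because \<open>\<alpha> < 1\<close>.
\<close>

lemma stable_transient:
  assumes \<alpha>: "0 < \<alpha>" "\<alpha> < 1" and \<gamma>: "0 < \<gamma>" and iid: "iid_jumps M Z"
    and stable: "stable_law \<alpha> \<gamma> \<delta> (distr M borel (Z 1))"
  shows "transient M (random_walk Z)"
proof (rule transient_random_walkI[OF iid])
  interpret prob_space M using iid by (simp add: iid_jumps_def)
  note [measurable] = measurable_random_walk[OF iid]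
  fix K :: nat
  \<comment> \<open>The interval bound needs a positive radius, and \<open>K\<close> may be 0.\<close>
  define L where "L = real K + 1"
  have L: "L > 0" "real K \<le> L" by (auto simp: L_def)
  \<comment> \<open>The midpoint of \<open>1\<close> and \<open>1 / \<alpha>\<close>; the remaining exponent \<open>1 - q \<alpha>\<close> is then \<open>\<beta>\<close>.\<close>
  define q where "q = (1 + 1/\<alpha>) / 2"
  define \<beta> where "\<beta> = (1 - \<alpha>) / 2"
  have q: "q > 1" using \<alpha> by (simp add: q_def field_simps)
  have \<beta>: "\<beta> > 0" using \<alpha> by (simp add: \<beta>_def)
  define c where "c = \<gamma> powr \<alpha> / L powr \<alpha>"
  have c: "c > 0" using \<gamma> L by (simp add: c_def)
  have upper: "prob {\<omega> \<in> space M. \<bar>random_walk Z n \<omega>\<bar> \<le> real K}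
      \<le> exp (1/2) * (2 * real n powr (-q) + exp (- (c * real n powr \<beta>)))" if "n > 0" for n
  proof -
    let ?\<mu> = "distr M borel (random_walk Z n)"
    have char: "cmod (char ?\<mu> t) = exp (- (real n * \<gamma> powr \<alpha> * \<bar>t\<bar> powr \<alpha>))" for t
    proof -
      have "cmod (char ?\<mu> t) = exp (- (\<gamma> powr \<alpha> * \<bar>t\<bar> powr \<alpha>)) ^ n"
        using stable by (simp add: char_random_walk[OF iid] stable_law_def norm_power norm_exp_eq_Re)
      then show ?thesis
        by (simp add: exp_of_nat_mult[symmetric] mult.assoc)
    qed
    have "prob {\<omega> \<in> space M. \<bar>random_walk Z n \<omega>\<bar> \<le> real K} \<le> prob {\<omega> \<in> space M. \<bar>random_walk Z n \<omega>\<bar> \<le> L}"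
      using L by (intro finite_measure_mono) auto
    also have "\<dots> = measure ?\<mu> {-L..L}"
      by (subst measure_distr) (auto intro!: arg_cong[where f=prob])
    also have "\<dots> \<le> exp (1/2) * (2 * real n powr (-q)
        + exp (- (real n * \<gamma> powr \<alpha> * (real n powr (-q) / L) powr \<alpha>)))"
      using \<alpha> L by (intro prob_interval_le_of_char_decay real_distribution_random_walk iid)
        (auto simp: char)
    also have "real n * \<gamma> powr \<alpha> * (real n powr (-q) / L) powr \<alpha> = c * real n powr (1 + - q * \<alpha>)"
    proof -
      have "(real n powr (-q) / L) powr \<alpha> = real n powr (- q * \<alpha>) / L powr \<alpha>"
        using L by (simp add: powr_divide powr_powr)
      moreover have "real n powr (1 + - q * \<alpha>) = real n * real n powr (- q * \<alpha>)"
        using that by (subst powr_add) simp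
      ultimately show ?thesis by (simp add: c_def)
    qed
    also have "1 + - q * \<alpha> = \<beta>"
      using \<alpha> by (simp add: q_def \<beta>_def field_simps)
    finally show ?thesis .
  qed
  have "(\<lambda>n. exp (- (c * real n powr \<beta>))) \<in> O(\<lambda>n. real n powr (-2))"
    using c \<beta> by real_asymp
  then have "summable (\<lambda>n. exp (- (c * real n powr \<beta>)))"
    by (rule summable_comparison_test_bigo[rotated]) (simp add: summable_real_powr_iff)
  moreover have "summable (\<lambda>n. real n powr (-q))"
    using q by (simp add: summable_real_powr_iff)
  ultimately have "summable (\<lambda>n. exp (1/2) * (2 * real n powr (-q) + exp (- (c * real n powr \<beta>))))"
    by (intro summable_mult summable_add)
  then show "summable (\<lambda>n. prob {\<omega> \<in> space M. \<bar>random_walk Z n \<omega>\<bar> \<le> real K})"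
    by (rule summable_comparison_test_ev[rotated])
      (use upper in \<open>auto simp: eventually_sequentially intro!: exI[of _ 1]\<close>)
qed

theorem corollary1p5:
  fixes M :: "'a measure"
  shows "(\<forall>\<alpha> \<gamma> Z. 1 < \<alpha> \<and> \<alpha> < 2 \<and> 0 < \<gamma> \<and> iid_jumps M Z \<and>
              stable_law \<alpha> \<gamma> 0 (distr M borel (Z 1))
            \<longrightarrow> recurrent M (random_walk Z)) \<and>
         (\<forall>\<alpha> \<gamma> \<delta> Z. 0 < \<alpha> \<and> \<alpha> < 1 \<and> 0 < \<gamma> \<and> iid_jumps M Z \<and>
              stable_law \<alpha> \<gamma> \<delta> (distr M borel (Z 1))
            \<longrightarrow> transient M (random_walk Z))"
  using stable_symmetric_recurrent stable_transient by blast

end
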